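(* Let $G$ be a simple graph on vertex set $\{1,\ldots,n\}$, $n\ge2$, with Laplacian matrix $L=D-A$ ($A$ the adjacency matrix, $D$ the diagonal matrix of degrees). Consider the Markov chain $(X_k)_{k\ge0}$ on $\{1,\ldots,n\}$ with transition matrix $P=I-(n-1)^{-1}L$, and let $K$ be a random variable independent of the chain with $\Pr\{K=k\}=\frac1n\left(1-\frac1n\right)^k$, $k=0,1,2,\ldots$. Let $Q=(q_{ij})$ with $q_{ij}=\Pr\{X_K=j\mid X_0=i\}$. Then $Q=F$, where $F=(f_{ij})_{n\times n}/f$ is the doubly stochastic graph matrix of $G$.
   Context: A spanning rooted forest of $G$ is a spanning acyclic subgraph in which exactly one vertex (the root) is marked in each tree. $f_{ij}$ is the number of spanning rooted forests of $G$ in which $i$ and $j$ lie in the same tree and that tree is rooted at $i$; $f$ is the total number of spanning rooted forests of $G$. *)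

theory Defs
  imports "HOL-Probability.Probability"
begin

text \<open>The vertex set is the whole finite type \<open>'n\<close>, so that \<open>n = CARD('n)\<close>; a graph is given by
  its set of edges, each edge being a two-element set of vertices.\<close>

definition simple_graph :: "'n::finite set set \<Rightarrow> bool" where
  "simple_graph E \<longleftrightarrow> (\<forall>e\<in>E. card e = 2)"

definition adjacency_matrix :: "'n::finite set set \<Rightarrow> real ^ 'n ^ 'n" where
  "adjacency_matrix E = (\<chi> i j. if {i, j} \<in> E then 1 else 0)"

definition degree_matrix :: "'n::finite set set \<Rightarrow> real ^ 'n ^ 'n" where
  "degree_matrix E = (\<chi> i j. if i = j then real (card {e \<in> E. i \<in> e}) else 0)"

definition laplacian :: "'n::finite set set \<Rightarrow> real ^ 'n ^ 'n" where
  "laplacian E = degree_matrix E - adjacency_matrix E"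

definition transition_matrix :: "'n::finite set set \<Rightarrow> real ^ 'n ^ 'n" where
  "transition_matrix E = mat 1 - inverse (real CARD('n) - 1) *\<^sub>R laplacian E"

text \<open>A cycle is listed by its vertices, without repeating the initial vertex at the end.\<close>

definition is_cycle :: "'n set set \<Rightarrow> 'n list \<Rightarrow> bool" where
  "is_cycle T vs \<longleftrightarrow> length vs \<ge> 3 \<and> distinct vs \<and>
     (\<forall>k<length vs. {vs ! k, vs ! (Suc k mod length vs)} \<in> T)"

definition acyclic_edges :: "'n set set \<Rightarrow> bool" where
  "acyclic_edges T \<longleftrightarrow> (\<nexists>vs. is_cycle T vs)"

definition component_of :: "'n set set \<Rightarrow> 'n \<Rightarrow> 'n set" where
  "component_of T v = {u. (v, u) \<in> {(x, y). {x, y} \<in> T}\<^sup>*}"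

text \<open>A spanning rooted forest is a pair of its edge set and its set of marked vertices (roots);
  the trees are the connected components of the spanning subgraph.\<close>

definition spanning_rooted_forests :: "'n::finite set set \<Rightarrow> ('n set set \<times> 'n set) set" where
  "spanning_rooted_forests E =
     {(T, R). T \<subseteq> E \<and> acyclic_edges T \<and> (\<forall>v. \<exists>!r. r \<in> component_of T v \<and> r \<in> R)}"

definition forest_count :: "'n::finite set set \<Rightarrow> nat" where
  "forest_count E = card (spanning_rooted_forests E)"

definition forest_count_rooted :: "'n::finite set set \<Rightarrow> 'n \<Rightarrow> 'n \<Rightarrow> nat" where
  "forest_count_rooted E i j =
     card {(T, R) \<in> spanning_rooted_forests E. j \<in> component_of T i \<and> i \<in> R}"

definition doubly_stochastic_graph_matrix :: "'n::finite set set \<Rightarrow> real ^ 'n ^ 'n" where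
  "doubly_stochastic_graph_matrix E =
     (\<chi> i j. real (forest_count_rooted E i j) / real (forest_count E))"

text \<open>Time-homogeneous Markov chain with arbitrary initial distribution. As \<^const>\<open>cond_prob\<close> is a
  quotient, the transition law is imposed only on histories of positive probability.\<close>

definition markov_chain :: "'a measure \<Rightarrow> (nat \<Rightarrow> 'a \<Rightarrow> 'n::finite) \<Rightarrow> real ^ 'n ^ 'n \<Rightarrow> bool" where
  "markov_chain M X P \<longleftrightarrow> prob_space M \<and>
     (\<forall>k. X k \<in> measurable M (count_space UNIV)) \<and>
     (\<forall>k x y. \<P>(\<omega> in M. \<forall>l\<le>k. X l \<omega> = x l) > 0 \<longrightarrow>
        \<P>(\<omega> in M. X (Suc k) \<omega> = y \<bar> \<forall>l\<le>k. X l \<omega> = x l) = P $ x k $ y)"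

text \<open>Independence of \<open>K\<close> from the whole process, via the generated \<open>\<sigma>\<close>-algebras
  (\<open>indep_var\<close> would force both variables to have the same value type).\<close>

definition independent_of_process ::
    "'a measure \<Rightarrow> ('a \<Rightarrow> nat) \<Rightarrow> (nat \<Rightarrow> 'a \<Rightarrow> 'n::finite) \<Rightarrow> bool" where
  "independent_of_process M K X \<longleftrightarrow>
     prob_space.indep_set M
       (sets (vimage_algebra (space M) K (count_space UNIV)))
       (sets (vimage_algebra (space M) (\<lambda>\<omega> k. X k \<omega>) (Pi\<^sub>M UNIV (\<lambda>_. count_space UNIV))))"

definition stopped_transition_matrix ::
    "'a measure \<Rightarrow> (nat \<Rightarrow> 'a \<Rightarrow> 'n::finite) \<Rightarrow> ('a \<Rightarrow> nat) \<Rightarrow> real ^ 'n ^ 'n" where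
  "stopped_transition_matrix M X K = (\<chi> i j. \<P>(\<omega> in M. X (K \<omega>) \<omega> = j \<bar> X 0 \<omega> = i))"

end

theory Submission
  imports Defs
begin

text \<open>Splitting off the last step before time \<open>K\<close> shows that the row \<open>q\<close> of \<open>Q\<close> at \<open>i\<close> satisfies
  \<open>q = e\<^sub>i / n + (1 - 1/n) q P\<close>, that is \<open>q (I + L) = e\<^sub>i\<close>. It remains to see that \<open>F (I + L) = I\<close>, i.e.
  \<open>f\<^sub>i\<^sub>j (1 + deg j) = \<delta>\<^sub>i\<^sub>j f + \<Sum>\<^sub>k f\<^sub>i\<^sub>k\<close> with \<open>k\<close> ranging over the neighbours of \<open>j\<close>. A forest in which \<open>j\<close> is
  not a root arises uniquely from a forest in which \<open>j\<close> is a root by joining \<open>j\<close> to a neighbour \<open>m\<close>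
  in another tree and unmarking \<open>j\<close> (delete the first edge of the path from \<open>j\<close> to its root). The
  identity already holds on each class of forests having the same such origin.\<close>

subsection \<open>Spanning rooted forests\<close>

lemma component_of_refl [simp]: "v \<in> component_of T v"
  by (simp add: component_of_def)

lemma component_of_sym: "u \<in> component_of T v \<longleftrightarrow> v \<in> component_of T u"
proof -
  have "sym ({(x, y). {x, y} \<in> T}\<^sup>*)"
    by (rule sym_rtrancl) (auto simp: sym_def insert_commute)
  then show ?thesis
    by (auto simp: component_of_def sym_def)
qed

lemma component_of_trans:
  "v \<in> component_of T u \<Longrightarrow> w \<in> component_of T v \<Longrightarrow> w \<in> component_of T u"
  by (auto simp: component_of_def)

lemma component_of_eq: "u \<in> component_of T v \<Longrightarrow> component_of T u = component_of T v"
  by (metis component_of_sym component_of_trans subsetI subset_antisym)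

lemma component_of_edge: "{u, v} \<in> T \<Longrightarrow> v \<in> component_of T u"
  by (auto simp: component_of_def)

lemma component_of_mono: "T \<subseteq> T' \<Longrightarrow> component_of T v \<subseteq> component_of T' v"
  unfolding component_of_def by (auto elim: rtrancl_mono[THEN subsetD, rotated])

text \<open>\<open>rtrancl_insert\<close> is applied once per orientation of the new edge; symmetry
  and transitivity of reachability absorb the routes that cross it more than once.\<close>

lemma component_of_insert:
  "y \<in> component_of (insert {a, b} T) x \<longleftrightarrow>
     y \<in> component_of T x \<or> a \<in> component_of T x \<and> y \<in> component_of T b \<or>
     b \<in> component_of T x \<and> y \<in> component_of T a"
proof -
  have "{(x, y). {x, y} \<in> insert {a, b} T} = insert (a, b) (insert (b, a) {(x, y). {x, y} \<in> T})"
    by (auto simp: doubleton_eq_iff)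
  then have "y \<in> component_of (insert {a, b} T) x \<longleftrightarrow>
      (y \<in> component_of T x \<or> b \<in> component_of T x \<and> y \<in> component_of T a) \<or>
      (a \<in> component_of T x \<or> b \<in> component_of T x \<and> a \<in> component_of T a) \<and>
      (y \<in> component_of T b \<or> b \<in> component_of T b \<and> y \<in> component_of T a)"
    by (simp add: component_of_def rtrancl_insert)
  then show ?thesis
    by (metis component_of_refl component_of_sym component_of_trans)
qed

text \<open>Induction from the front of the path: a new first vertex is prepended, unless the walk
  already visits it; then the walk is cut to start there.\<close>

lemma component_of_distinct_walk:
  assumes "y \<in> component_of T x"
  obtains vs where "vs \<noteq> []" "hd vs = x" "last vs = y" "distinct vs"
    "\<And>k. Suc k < length vs \<Longrightarrow> {vs ! k, vs ! Suc k} \<in> T"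
proof -
  have "(x, y) \<in> {(x, y). {x, y} \<in> T}\<^sup>*"
    using assms by (simp add: component_of_def)
  then have "\<exists>vs. vs \<noteq> [] \<and> hd vs = x \<and> last vs = y \<and> distinct vs \<and>
    (\<forall>k. Suc k < length vs \<longrightarrow> {vs ! k, vs ! Suc k} \<in> T)"
  proof (induction rule: converse_rtrancl_induct)
    case base
    show ?case by (rule exI[of _ "[y]"]) auto
  next
    case (step x z)
    then obtain vs where vs: "vs \<noteq> []" "hd vs = z" "last vs = y" "distinct vs"
      "\<And>k. Suc k < length vs \<Longrightarrow> {vs ! k, vs ! Suc k} \<in> T" by blast
    show ?case
    proof (cases "x \<in> set vs")
      case True
      then obtain n where n: "n < length vs" "vs ! n = x"
        by (auto simp: in_set_conv_nth)
      show ?thesis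
        using vs n by (intro exI[of _ "drop n vs"]) (auto simp: hd_drop_conv_nth)
    next
      case False
      have "{(x # vs) ! k, (x # vs) ! Suc k} \<in> T" if "Suc k < length (x # vs)" for k
        using vs step.hyps(1) that by (cases k) (auto simp: hd_conv_nth)
      then show ?thesis
        using vs False by (intro exI[of _ "x # vs"]) auto
    qed
  qed
  then show ?thesis using that by blast
qed

text \<open>Replaces cycle lists by reachability, which is easier to follow when edges are added or
  removed: a cycle through an edge is that edge together with a distinct walk between its ends that
  avoids it. The condition \<open>a \<noteq> b\<close> exempts singleton edges, which lie on no
  cycle.\<close>

lemma acyclic_edges_iff_bridges:
  "acyclic_edges T \<longleftrightarrow>
     (\<forall>a b. {a, b} \<in> T \<longrightarrow> a \<noteq> b \<longrightarrow> b \<notin> component_of (T - {{a, b}}) a)"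
proof (intro iffI allI impI notI)
  fix a b
  assume T: "acyclic_edges T" "{a, b} \<in> T" "a \<noteq> b" and "b \<in> component_of (T - {{a, b}}) a"
  then obtain vs where vs: "vs \<noteq> []" "hd vs = a" "last vs = b" "distinct vs"
    and walk: "\<And>k. Suc k < length vs \<Longrightarrow> {vs ! k, vs ! Suc k} \<in> T - {{a, b}}"
    using component_of_distinct_walk by metis
  have ends: "vs ! 0 = a" "vs ! (length vs - 1) = b"
    using vs by (auto simp: hd_conv_nth last_conv_nth)
  have "length vs \<noteq> 1"
    using ends T by auto
  moreover have "length vs \<noteq> 2"
  proof
    assume "length vs = 2"
    then show False using walk[of 0] ends by auto
  qed
  ultimately have len: "length vs \<ge> 3"
    using vs(1) by (cases "length vs") auto
  have "{vs ! k, vs ! (Suc k mod length vs)} \<in> T" if "k < length vs" for k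
  proof (cases "Suc k = length vs")
    \<comment> \<open>At the last index \<open>mod\<close> wraps around to \<open>0\<close>, and the
      closing edge is the removed edge \<open>{a, b}\<close> itself.\<close>
    case True
    then have "k = length vs - 1" by simp
    with True ends T show ?thesis by (simp add: insert_commute)
  next
    case False
    then show ?thesis using walk[of k] that by auto
  qed
  then have "is_cycle T vs"
    using len vs by (auto simp: is_cycle_def)
  then show False using T by (auto simp: acyclic_edges_def)
next
  assume bridges: "\<forall>a b. {a, b} \<in> T \<longrightarrow> a \<noteq> b \<longrightarrow> b \<notin> component_of (T - {{a, b}}) a"
  show "acyclic_edges T"
    unfolding acyclic_edges_def
  proof
    assume "\<exists>vs. is_cycle T vs"
    then obtain vs where vs: "length vs \<ge> 3" "distinct vs"
      and cyc: "\<And>k. k < length vs \<Longrightarrow> {vs ! k, vs ! (Suc k mod length vs)} \<in> T"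
      by (auto simp: is_cycle_def)
    \<comment> \<open>\<open>?e\<close> is the closing edge of the cycle; the other edges form a
      walk from \<open>vs ! 0\<close> to \<open>vs ! n\<close>.\<close>
    define n where "n = length vs - 1"
    let ?e = "{vs ! 0, vs ! n}"
    have n: "length vs = Suc n" "n \<ge> 2" using vs n_def by auto
    have "vs ! k \<in> component_of (T - {?e}) (vs ! 0)" if "k \<le> n" for k
      using that
    proof (induction k)
      case (Suc k)
      have "{vs ! k, vs ! Suc k} \<in> T"
        using cyc[of k] Suc.prems n by simp
      \<comment> \<open>Here \<open>n \<ge> 2\<close> matters: with only two vertices the walk would
        consist of the closing edge.\<close>
      moreover have "{vs ! k, vs ! Suc k} \<noteq> ?e"
        using vs(2) Suc.prems n by (auto simp: doubleton_eq_iff nth_eq_iff_index_eq)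
      ultimately have "vs ! Suc k \<in> component_of (T - {?e}) (vs ! k)"
        by (intro component_of_edge) auto
      then show ?case using Suc component_of_trans by (metis Suc_leD)
    qed simp
    then have "vs ! n \<in> component_of (T - {?e}) (vs ! 0)" by simp
    moreover have "?e \<in> T" using cyc[of n] n by (simp add: insert_commute)
    moreover have "vs ! 0 \<noteq> vs ! n" using vs(2) n by (simp add: nth_eq_iff_index_eq)
    ultimately show False using bridges by blast
  qed
qed

lemma acyclic_edges_subset: "acyclic_edges T \<Longrightarrow> T' \<subseteq> T \<Longrightarrow> acyclic_edges T'"
  by (auto simp: acyclic_edges_def is_cycle_def)

text \<open>The new edge is a bridge by assumption. If an old edge \<open>{c, d}\<close> ceased to
  be one, the detour would run through \<open>{a, b}\<close>, so one end of \<open>{c, d}\<close>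
  would reach \<open>a\<close> and the other \<open>b\<close> in \<open>T\<close>; then
  \<open>{c, d}\<close> would connect \<open>a\<close> to \<open>b\<close> in
  \<open>T\<close>.\<close>

lemma acyclic_edges_insert:
  assumes "acyclic_edges T" "b \<notin> component_of T a"
  shows "acyclic_edges (insert {a, b} T)"
  unfolding acyclic_edges_iff_bridges
proof (intro allI impI notI)
  fix c d
  assume cd: "{c, d} \<in> insert {a, b} T" "c \<noteq> d"
    and conn: "d \<in> component_of (insert {a, b} T - {{c, d}}) c"
  have ab: "{a, b} \<notin> T"
    using assms(2) component_of_edge by metis
  show False
  proof (cases "{c, d} = {a, b}")
    case True
    then have "insert {a, b} T - {{c, d}} = T" using ab by auto
    then have "d \<in> component_of T c" using conn by simp
    then have "b \<in> component_of T a"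
      using True component_of_sym by (metis doubleton_eq_iff)
    then show False using assms(2) by simp
  next
    case False
    then have T: "{c, d} \<in> T" using cd by auto
    let ?T = "T - {{c, d}}"
    have "insert {a, b} T - {{c, d}} = insert {a, b} ?T" using False by auto
    then have "d \<in> component_of ?T c \<or> a \<in> component_of ?T c \<and> d \<in> component_of ?T b \<or>
      b \<in> component_of ?T c \<and> d \<in> component_of ?T a"
      using conn by (simp add: component_of_insert)
    moreover have "d \<notin> component_of ?T c"
      using T cd(2) assms(1) by (auto simp: acyclic_edges_iff_bridges)
    ultimately have "a \<in> component_of T c \<and> d \<in> component_of T b \<or>
      b \<in> component_of T c \<and> d \<in> component_of T a"
      using component_of_mono[of ?T T] by blast
    moreover have "d \<in> component_of T c" using T by (rule component_of_edge)
    ultimately have "b \<in> component_of T a"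
      by (metis component_of_sym component_of_trans)
    then show False using assms(2) by simp
  qed
qed

section \<open>Attaching and detaching the tree of a root\<close>

text \<open>The merged tree keeps the root of the tree of \<open>m\<close>, as \<open>j\<close>
  loses its mark; every other tree is untouched.\<close>

lemma spanning_rooted_forests_attach:
  assumes F: "(T, R) \<in> spanning_rooted_forests E" and j: "j \<in> R"
    and m: "{j, m} \<in> E" "m \<notin> component_of T j"
  shows "(insert {j, m} T, R - {j}) \<in> spanning_rooted_forests E"
proof -
  have T: "T \<subseteq> E" "acyclic_edges T"
    and root: "\<And>v. \<exists>!r. r \<in> component_of T v \<and> r \<in> R"
    using F by (auto simp: spanning_rooted_forests_def)
  have "\<exists>!r. r \<in> component_of (insert {j, m} T) v \<and> r \<in> R - {j}" for v
  proof (cases "v \<in> component_of T j")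
    case True
    obtain r where r: "r \<in> component_of T m" "r \<in> R"
      and r_uniq: "\<And>s. s \<in> component_of T m \<Longrightarrow> s \<in> R \<Longrightarrow> s = r"
      using root[of m] by blast
    have j_uniq: "s = j" if "s \<in> component_of T j" "s \<in> R" for s
      using root[of j] that j by auto
    show ?thesis
    proof (rule ex1I[of _ r])
      show "r \<in> component_of (insert {j, m} T) v \<and> r \<in> R - {j}"
        using True r m(2) by (auto simp: component_of_insert component_of_sym)
      show "s = r" if "s \<in> component_of (insert {j, m} T) v \<and> s \<in> R - {j}" for s
        using that True r_uniq j_uniq component_of_eq[OF True]
        by (auto simp: component_of_insert)
    qed
  next
    case False
    then have jv: "j \<notin> component_of T v" using component_of_sym by metis
    obtain r where r: "r \<in> component_of T v" "r \<in> R"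
      and r_uniq: "\<And>s. s \<in> component_of T v \<Longrightarrow> s \<in> R \<Longrightarrow> s = r"
      using root[of v] by blast
    have j_uniq: "s = j" if "s \<in> component_of T j" "s \<in> R" for s
      using root[of j] that j by auto
    show ?thesis
    proof (rule ex1I[of _ r])
      show "r \<in> component_of (insert {j, m} T) v \<and> r \<in> R - {j}"
        using r jv component_of_insert[of r j m T v] by blast
      fix s
      assume s: "s \<in> component_of (insert {j, m} T) v \<and> s \<in> R - {j}"
      \<comment> \<open>This rules out the case in which \<open>v\<close> lies in the tree of
        \<open>m\<close> and \<open>s\<close> in the old tree of \<open>j\<close>.\<close>
      then have "s \<notin> component_of T j" using j_uniq by blast
      then have "s \<in> component_of T v"
        using s jv component_of_insert[of s j m T v] by blast
      then show "s = r" using s r_uniq by blast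
    qed
  qed
  moreover have "acyclic_edges (insert {j, m} T)"
    using T(2) m(2) by (rule acyclic_edges_insert)
  ultimately show ?thesis
    using T m(1) by (simp add: spanning_rooted_forests_def)
qed

text \<open>The edge in question is the one taken after the last visit to \<open>j\<close>: from
  \<open>m\<close> on, the route to \<open>r\<close> no longer touches \<open>j\<close>.\<close>

lemma component_of_first_edge:
  assumes "r \<in> component_of T j" "r \<noteq> j"
  obtains m where "{j, m} \<in> T" "r \<in> component_of (T - {e. j \<in> e}) m"
proof -
  let ?U = "T - {e. j \<in> e}"
  have isolated: "u = j" if "u \<in> component_of ?U j" for u
    using that unfolding component_of_def
    by (auto elim: converse_rtranclE)
  have "r \<in> component_of ?U x \<or> (\<exists>m. {j, m} \<in> T \<and> r \<in> component_of ?U m)"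
    if "(x, r) \<in> {(x, y). {x, y} \<in> T}\<^sup>*" for x
    using that
  proof (induction rule: converse_rtrancl_induct)
    case (step x y)
    \<comment> \<open>If \<open>r\<close> is reached from \<open>y\<close> without edges at
      \<open>j\<close>, then \<open>y\<close> is not \<open>j\<close>, since \<open>j\<close> is
      isolated in \<open>?U\<close> and \<open>r \<noteq> j\<close>.\<close>
    then consider "\<exists>m. {j, m} \<in> T \<and> r \<in> component_of ?U m" | "x = j" "r \<in> component_of ?U y"
      | "x \<noteq> j" "y \<noteq> j" "r \<in> component_of ?U y"
      using isolated assms(2) by blast
    then show ?case
    proof cases
      case 3
      then have "{x, y} \<in> ?U" using step by auto
      then show ?thesis using 3 component_of_edge component_of_trans by metis
    qed (use step in auto)
  qed simp
  then show ?thesis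
    using isolated assms that unfolding component_of_def by blast
qed

text \<open>Removing the first edge from \<open>j\<close> towards its root splits the tree of
  \<open>j\<close>: the part with \<open>m\<close> retains the old root, and the part with
  \<open>j\<close> gets \<open>j\<close> as its root.\<close>

lemma spanning_rooted_forests_detach:
  assumes S: "simple_graph E" and F: "(T, R) \<in> spanning_rooted_forests E" and j: "j \<notin> R"
  obtains m where "{j, m} \<in> T" "m \<notin> component_of (T - {{j, m}}) j"
    "(T - {{j, m}}, insert j R) \<in> spanning_rooted_forests E"
proof -
  have T: "T \<subseteq> E" "acyclic_edges T"
    and root: "\<And>v. \<exists>!r. r \<in> component_of T v \<and> r \<in> R"
    using F by (auto simp: spanning_rooted_forests_def)
  obtain r where r: "r \<in> component_of T j" "r \<in> R"
    and r_uniq: "\<And>s. s \<in> component_of T j \<Longrightarrow> s \<in> R \<Longrightarrow> s = r"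
    using root[of j] by blast
  have "r \<noteq> j" using r j by blast
  then obtain m where m: "{j, m} \<in> T" and rm': "r \<in> component_of (T - {e. j \<in> e}) m"
    using component_of_first_edge r by metis
  let ?U = "T - {{j, m}}"
  have rm: "r \<in> component_of ?U m"
    using rm' component_of_mono[of "T - {e. j \<in> e}" ?U] by auto
  \<comment> \<open>Acyclicity does not exclude singleton edges; \<open>simple_graph\<close>
    does.\<close>
  have "card {j, m} = 2"
    using S m T by (auto simp: simple_graph_def)
  then have "j \<noteq> m" by auto
  then have jm: "m \<notin> component_of ?U j"
    using T(2) m by (auto simp: acyclic_edges_iff_bridges)
  have comp: "y \<in> component_of T x \<longleftrightarrow> y \<in> component_of ?U x \<or>
      j \<in> component_of ?U x \<and> y \<in> component_of ?U m \<or>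
      m \<in> component_of ?U x \<and> y \<in> component_of ?U j" for x y
    using component_of_insert[of y j m ?U x] m by (simp add: insert_absorb)
  have rj: "r \<notin> component_of ?U j"
    using rm jm by (metis component_of_sym component_of_trans)
  have "\<exists>!s. s \<in> component_of ?U v \<and> s \<in> insert j R" for v
  proof (cases "v \<in> component_of ?U j")
    case True
    then have eq: "component_of ?U v = component_of ?U j" by (rule component_of_eq)
    \<comment> \<open>Any old root on this side would have to be \<open>r\<close>, which lies on the
      side of \<open>m\<close>.\<close>
    show ?thesis unfolding eq
      using comp[of _ j] r_uniq rj by (intro ex1I[of _ j]) auto
  next
    case False
    then have jv: "j \<notin> component_of ?U v" using component_of_sym by metis
    obtain s where s: "s \<in> component_of T v" "s \<in> R"
      and s_uniq: "\<And>t. t \<in> component_of T v \<Longrightarrow> t \<in> R \<Longrightarrow> t = s"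
      using root[of v] by blast
    show ?thesis
    proof (cases "m \<in> component_of ?U v")
      case True
      then have "r \<in> component_of ?U v" using rm component_of_trans by metis
      then show ?thesis
        using jv s_uniq comp[of _ v] r by (intro ex1I[of _ r]) auto
    next
      case False
      then have "component_of T v = component_of ?U v"
        using jv comp[of _ v] by blast
      then show ?thesis
        using jv s s_uniq by (metis insert_iff)
    qed
  qed
  then have "(?U, insert j R) \<in> spanning_rooted_forests E"
    using T acyclic_edges_subset[of T ?U] by (auto simp: spanning_rooted_forests_def)
  then show ?thesis using that m jm by blast
qed


lemma spanning_rooted_forests_root_unique:
  assumes "(T, R) \<in> spanning_rooted_forests E" "r \<in> R" "s \<in> R" "s \<in> component_of T r"
  shows "s = r"
proof -
  have "\<exists>!u. u \<in> component_of T r \<and> u \<in> R"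
    using assms(1) by (simp add: spanning_rooted_forests_def)
  then show ?thesis using assms(2-4) by (metis component_of_refl)
qed

text \<open>Surjectivity is detachment. Injectivity requires the added edge to be recoverable from
  the result: among the edges at \<open>j\<close>, it is the one that leads to the root.\<close>

lemma spanning_rooted_forests_bij_attach:
  fixes E :: "'n::finite set set"
  assumes S: "simple_graph E"
  shows "bij_betw (\<lambda>((T, R), m). (insert {j, m} T, R - {j}))
    (SIGMA F:{F \<in> spanning_rooted_forests E. j \<in> snd F}. {m. {j, m} \<in> E \<and> m \<notin> component_of (fst F) j})
    {F \<in> spanning_rooted_forests E. j \<notin> snd F}"
    (is "bij_betw ?\<phi> ?A ?B")
  unfolding bij_betw_def
proof
  show "inj_on ?\<phi> ?A"
  proof (rule inj_onI, clarsimp)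
    fix T R m T' R' m'
    assume F: "(T, R) \<in> spanning_rooted_forests E" "j \<in> R" "m \<notin> component_of T j"
      and F': "(T', R') \<in> spanning_rooted_forests E" "j \<in> R'" "m' \<notin> component_of T' j"
      and T: "insert {j, m} T = insert {j, m'} T'" and "R - {j} = R' - {j}"
    then have R: "R = R'" by blast
    have jm: "{j, m} \<notin> T" "{j, m'} \<notin> T'"
      using F(3) F'(3) component_of_edge by metis+
    have "m = m'"
    proof (rule ccontr)
      assume "m \<noteq> m'"
      then have ne: "{j, m} \<noteq> {j, m'}" by (auto simp: doubleton_eq_iff)
      obtain r where r: "r \<in> component_of T' m'" "r \<in> R'"
        using F'(1) unfolding spanning_rooted_forests_def by blast
      \<comment> \<open>\<open>T'\<close> is the common part \<open>U\<close> with
        \<open>{j, m}\<close>, and \<open>T\<close> is \<open>U\<close> with \<open>{j, m'}\<close>.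
        The root \<open>r\<close> of the tree of \<open>m'\<close> in \<open>T'\<close> is already
        reached within \<open>U\<close>, so in \<open>T\<close> it shares a tree with the root
        \<open>j\<close>.\<close>
      define U where "U = T' - {{j, m}}"
      have U: "T' = insert {j, m} U" "T = insert {j, m'} U"
        using T jm ne by (auto simp: U_def)
      have "j \<notin> component_of T' m'"
        using F'(3) component_of_sym by metis
      then have "r \<in> component_of U m'"
        using r(1) unfolding U component_of_insert by (metis component_of_refl)
      then have "r \<in> component_of T j"
        unfolding U component_of_insert by simp
      then have "r = j"
        using spanning_rooted_forests_root_unique F(1,2) r(2) R by metis
      then show False
        using r(1) \<open>j \<notin> component_of T' m'\<close> by simp
    qed
    then have "T = T'" using T jm by (metis insert_ident)
    then show "T = T' \<and> R = R' \<and> m = m'" using \<open>m = m'\<close> R by simp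
  qed
  show "?\<phi> ` ?A = ?B"
  proof
    show "?\<phi> ` ?A \<subseteq> ?B"
      using spanning_rooted_forests_attach by fastforce
    show "?B \<subseteq> ?\<phi> ` ?A"
    proof clarsimp
      fix T R
      assume F: "(T, R) \<in> spanning_rooted_forests E" "j \<notin> R"
      then obtain m where m: "{j, m} \<in> T" "m \<notin> component_of (T - {{j, m}}) j"
        "(T - {{j, m}}, insert j R) \<in> spanning_rooted_forests E"
        using spanning_rooted_forests_detach[OF S] by metis
      moreover have "{j, m} \<in> E"
        using F m(1) by (auto simp: spanning_rooted_forests_def)
      ultimately have "((T - {{j, m}}, insert j R), m) \<in> ?A" by simp
      moreover have "(T, R) = ?\<phi> ((T - {{j, m}}, insert j R), m)"
        using m(1) F(2) by auto
      ultimately show "(T, R) \<in> ?\<phi> ` ?A" by (rule rev_image_eqI)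
    qed
  qed
qed

section \<open>Counting forests by their origin\<close>

text \<open>Each group consists of a forest with root \<open>j\<close> and all its attachments, so
  an identity between sums over all forests can be checked group by group.\<close>

lemma sum_spanning_rooted_forests:
  fixes E :: "'n::finite set set" and g :: "'n set set \<times> 'n set \<Rightarrow> real"
  assumes S: "simple_graph E"
  shows "(\<Sum>F\<in>spanning_rooted_forests E. g F) =
    (\<Sum>(T, R) | (T, R) \<in> spanning_rooted_forests E \<and> j \<in> R.
       g (T, R) + (\<Sum>m | {j, m} \<in> E \<and> m \<notin> component_of T j. g (insert {j, m} T, R - {j})))"
proof -
  let ?A = "{F \<in> spanning_rooted_forests E. j \<in> snd F}"
  let ?N = "\<lambda>F. {m. {j, m} \<in> E \<and> m \<notin> component_of (fst F) j}"
  have "(\<Sum>F\<in>spanning_rooted_forests E. g F) =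
      (\<Sum>F\<in>?A. g F) + (\<Sum>F | F \<in> spanning_rooted_forests E \<and> j \<notin> snd F. g F)"
    by (subst sum.union_disjoint[symmetric]) (auto intro!: sum.cong)
  also have "(\<Sum>F | F \<in> spanning_rooted_forests E \<and> j \<notin> snd F. g F) =
      (\<Sum>(F, m)\<in>Sigma ?A ?N. g (insert {j, m} (fst F), snd F - {j}))"
    by (subst sum.reindex_bij_betw[OF spanning_rooted_forests_bij_attach[OF S], symmetric])
       (auto intro!: sum.cong)
  also have "\<dots> = (\<Sum>F\<in>?A. \<Sum>m\<in>?N F. g (insert {j, m} (fst F), snd F - {j}))"
    by (subst sum.Sigma) auto
  also have "(\<Sum>F\<in>?A. g F) + \<dots> =
      (\<Sum>F\<in>?A. g F + (\<Sum>m\<in>?N F. g (insert {j, m} (fst F), snd F - {j})))"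
    by (simp add: sum.distrib)
  also have "\<dots> = (\<Sum>(T, R) | (T, R) \<in> spanning_rooted_forests E \<and> j \<in> R.
       g (T, R) + (\<Sum>m | {j, m} \<in> E \<and> m \<notin> component_of T j. g (insert {j, m} T, R - {j})))"
    by (intro sum.cong) auto
  finally show ?thesis .
qed

text \<open>Degrees are defined by incident edges, while the forest identity counts neighbours; an
  edge of size two at \<open>j\<close> has exactly one other end.\<close>

lemma card_incident_edges:
  assumes "simple_graph E"
  shows "card {e \<in> E. j \<in> e} = card {k. {j, k} \<in> E}"
proof -
  have "(\<lambda>k. {j, k}) ` {k. {j, k} \<in> E} = {e \<in> E. j \<in> e}"
  proof
    show "{e \<in> E. j \<in> e} \<subseteq> (\<lambda>k. {j, k}) ` {k. {j, k} \<in> E}"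
    proof clarify
      fix e assume e: "e \<in> E" "j \<in> e"
      then have "card e = 2" using assms by (simp add: simple_graph_def)
      then obtain x y where "e = {x, y}" by (auto simp: card_2_iff)
      then obtain k where "e = {j, k}" using e(2) by (metis insert_commute insertE singletonD)
      then show "e \<in> (\<lambda>k. {j, k}) ` {k. {j, k} \<in> E}" using e by blast
    qed
  qed auto
  moreover have "inj_on (\<lambda>k. {j, k}) {k. {j, k} \<in> E}"
    by (auto intro!: inj_onI simp: doubleton_eq_iff)
  then have "card ((\<lambda>k. {j, k}) ` {k. {j, k} \<in> E}) = card {k. {j, k} \<in> E}"
    by (rule card_image)
  ultimately show ?thesis by simp
qed

text \<open>Fix a forest in which \<open>j\<close> is a root. If \<open>a\<close>, \<open>b\<close>, \<open>c\<close> count the neighbours of \<open>j\<close> in the tree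
  of \<open>i\<close>, in the tree of \<open>j\<close> and elsewhere, then for \<open>i \<noteq> j\<close> the two sides receive from this forest
  and all its attachments \<open>a (1 + a + b + c)\<close> and \<open>(1 + a + c) a + a b\<close>, respectively.\<close>

lemma forest_count_rooted_balance:
  fixes E :: "'n::finite set set"
  assumes S: "simple_graph E"
  shows "real (forest_count_rooted E i j) * (1 + real (card {k. {j, k} \<in> E})) =
    (if i = j then real (forest_count E) else 0) + (\<Sum>k | {j, k} \<in> E. real (forest_count_rooted E i k))"
proof -
  define t :: "'n set set \<times> 'n set \<Rightarrow> 'n \<Rightarrow> real"
    where "t F k = of_bool (i \<in> snd F \<and> k \<in> component_of (fst F) i)" for F k
  define d where "d = real (card {k. {j, k} \<in> E})"
  \<comment> \<open>\<open>h F\<close> is the defect of the identity at the single forest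
    \<open>F\<close>; the claim is that these defects sum to \<open>0\<close>.\<close>
  define h where "h F = t F j * (1 + d) - (\<Sum>k | {j, k} \<in> E. t F k) - of_bool (i = j)" for F
  have count: "real (forest_count_rooted E i k) = (\<Sum>F\<in>spanning_rooted_forests E. t F k)" for k
  proof -
    have "(\<Sum>F\<in>spanning_rooted_forests E. t F k) =
        real (card (spanning_rooted_forests E \<inter> {F. i \<in> snd F \<and> k \<in> component_of (fst F) i}))"
      unfolding t_def by (subst sum_of_bool_eq) auto
    also have "spanning_rooted_forests E \<inter> {F. i \<in> snd F \<and> k \<in> component_of (fst F) i} =
        {(T, R) \<in> spanning_rooted_forests E. k \<in> component_of T i \<and> i \<in> R}"
      by auto
    finally show ?thesis by (simp add: forest_count_rooted_def)
  qed
  have "h (T, R) + (\<Sum>m | {j, m} \<in> E \<and> m \<notin> component_of T j. h (insert {j, m} T, R - {j})) = 0"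
    if F: "(T, R) \<in> spanning_rooted_forests E" and j: "j \<in> R" for T R
  proof -
    \<comment> \<open>\<open>?N\<close> holds the neighbours to which \<open>j\<close> can be
      attached, \<open>?B\<close> those already in its tree.\<close>
    let ?N = "{m. {j, m} \<in> E \<and> m \<notin> component_of T j}"
    let ?B = "{m. {j, m} \<in> E \<and> m \<in> component_of T j}"
    have nbrs: "{k. {j, k} \<in> E} = ?B \<union> ?N" and disj: "?B \<inter> ?N = {}" by auto
    have d: "d = real (card ?B) + real (card ?N)"
      unfolding d_def nbrs by (subst card_Un_disjoint) (use disj in auto)
    have sum_nbrs: "(\<Sum>k | {j, k} \<in> E. g k) = (\<Sum>k\<in>?B. g k) + (\<Sum>k\<in>?N. g k)" for g :: "'n \<Rightarrow> real"
      unfolding nbrs by (subst sum.union_disjoint) (use disj in auto)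
    have uniq: "s = j" if "s \<in> component_of T j" "s \<in> R" for s
      using spanning_rooted_forests_root_unique F that j by metis
    show ?thesis
    proof (cases "i = j")
      \<comment> \<open>The forest itself contributes \<open>card ?N\<close>, and each of its
        \<open>card ?N\<close> attachments contributes \<open>-1\<close>, as \<open>j\<close> is no
        longer marked there.\<close>
      case True
      have "(\<Sum>k\<in>?B. t (T, R) k) = card ?B"
        using True j by (simp add: t_def)
      moreover have "(\<Sum>k\<in>?N. t (T, R) k) = 0"
        using True j by (intro sum.neutral) (auto simp: t_def)
      moreover have "t (T, R) j = 1" using True j by (simp add: t_def)
      ultimately have "h (T, R) = card ?N"
        using True by (simp add: h_def d sum_nbrs)
      moreover have "h (insert {j, m} T, R - {j}) = -1" for m
        using True by (simp add: h_def t_def)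
      ultimately show ?thesis by simp
    next
      case False
      have tB: "t (T, R) k = 0" if "k \<in> component_of T j" for k
      proof (rule ccontr)
        assume "t (T, R) k \<noteq> 0"
        then have "i \<in> R" "k \<in> component_of T i" by (auto simp: t_def)
        moreover have "i \<in> component_of T j"
          using \<open>k \<in> component_of T i\<close> that by (metis component_of_sym component_of_trans)
        ultimately show False using uniq False by blast
      qed
      \<comment> \<open>The number of neighbours of \<open>j\<close> in the tree rooted at
        \<open>i\<close>, or \<open>0\<close> if \<open>i\<close> is not a root.\<close>
      define a where "a = (\<Sum>k\<in>?N. t (T, R) k)"
      have h0: "h (T, R) = - a"
        using False by (simp add: h_def sum_nbrs tB a_def)
      have "h (insert {j, m} T, R - {j}) = t (T, R) m * (1 + card ?N) - a"
        if m: "m \<in> ?N" for m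
      proof -
        let ?F = "(insert {j, m} T, R - {j})"
        \<comment> \<open>Attachment merges the tree of \<open>j\<close> into that of
          \<open>m\<close>, so its vertices now count exactly when \<open>m\<close> did
          before.\<close>
        have tj: "t ?F k = t (T, R) m" if k: "k \<in> component_of T j" for k
        proof (cases "i \<in> R")
          case True
          have ij: "i \<notin> component_of T j" using uniq True False by blast
          then have "j \<notin> component_of T i" using component_of_sym by metis
          moreover have "k \<notin> component_of T i"
            using ij k by (metis component_of_sym component_of_trans)
          ultimately show ?thesis
            using False True k by (auto simp: t_def component_of_insert)
        qed (simp add: t_def)
        have to: "t ?F k = t (T, R) k" if k: "k \<notin> component_of T j" for k
        proof (cases "i \<in> R")
          case True
          have ij: "i \<notin> component_of T j" using uniq True False by blast
          then have "j \<notin> component_of T i" using component_of_sym by metis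
          then show ?thesis
            using False True k by (auto simp: t_def component_of_insert)
        qed (simp add: t_def)
        have "(\<Sum>k\<in>?B. t ?F k) = (\<Sum>k\<in>?B. t (T, R) m)"
          by (rule sum.cong) (auto simp: tj)
        moreover have "(\<Sum>k\<in>?N. t ?F k) = a"
          unfolding a_def by (rule sum.cong) (auto simp: to)
        ultimately show ?thesis
          using False tj[of j] by (simp add: h_def sum_nbrs d algebra_simps)
      qed
      then have "(\<Sum>m\<in>?N. h (insert {j, m} T, R - {j})) = (\<Sum>m\<in>?N. t (T, R) m * (1 + card ?N) - a)"
        by (rule sum.cong[OF refl])
      \<comment> \<open>The values \<open>t (T, R) m\<close> add up to \<open>a\<close>; the
        difference is \<open>a\<close>, which cancels \<open>h (T, R) = - a\<close>.\<close>
      also have "\<dots> = a * (1 + card ?N) - card ?N * a"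
        by (simp add: sum_subtractf sum_distrib_right a_def)
      finally show ?thesis using h0 by (simp add: algebra_simps)
    qed
  qed
  then have "(\<Sum>F\<in>spanning_rooted_forests E. h F) = 0"
    unfolding sum_spanning_rooted_forests[OF S, of h j] by (intro sum.neutral) auto
  then have "(\<Sum>F\<in>spanning_rooted_forests E. t F j) * (1 + d) =
      (\<Sum>F\<in>spanning_rooted_forests E. \<Sum>k | {j, k} \<in> E. t F k) + forest_count E * of_bool (i = j)"
    by (simp add: h_def sum_subtractf sum_distrib_right forest_count_def)
  then show ?thesis
    unfolding count d_def by (subst (asm) sum.swap) auto
qed

text \<open>Justifies dividing by \<open>forest_count\<close>: the edgeless forest with every vertex
  a root always counts.\<close>

lemma forest_count_pos: "0 < forest_count (E :: 'n::finite set set)"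
proof -
  have "component_of {} v = {v}" for v :: 'n
    by (simp add: component_of_def)
  then have "({}, UNIV) \<in> spanning_rooted_forests E"
    by (auto simp: spanning_rooted_forests_def acyclic_edges_def is_cycle_def intro!: exI[of _ 0])
  then show ?thesis
    unfolding forest_count_def by (subst card_gt_0_iff) auto
qed

section \<open>The forest identity in matrix form\<close>

lemma matrix_mult_one_plus_laplacian:
  fixes E :: "'n::finite set set" and A :: "real ^ 'n ^ 'm::finite"
  assumes "simple_graph E"
  shows "(A ** (mat 1 + laplacian E)) $ i $ j =
    A $ i $ j * (1 + real (card {k. {j, k} \<in> E})) - (\<Sum>k | {j, k} \<in> E. A $ i $ k)"
proof -
  let ?d = "real (card {k. {j, k} \<in> E})"
  have "(A ** (mat 1 + laplacian E)) $ i $ j =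
      (\<Sum>k\<in>UNIV. (if k = j then A $ i $ k * (1 + ?d) else 0) - (if {j, k} \<in> E then A $ i $ k else 0))"
    unfolding matrix_matrix_mult_def
    by (auto intro!: sum.cong simp: laplacian_def degree_matrix_def adjacency_matrix_def mat_def
          card_incident_edges[OF assms] insert_commute algebra_simps)
  also have "\<dots> = A $ i $ j * (1 + ?d) - (\<Sum>k\<in>UNIV. if {j, k} \<in> E then A $ i $ k else 0)"
    by (simp add: sum_subtractf)
  also have "(\<Sum>k\<in>UNIV. if {j, k} \<in> E then A $ i $ k else 0) = (\<Sum>k | {j, k} \<in> E. A $ i $ k)"
    by (simp add: sum.If_cases)
  finally show ?thesis .
qed

text \<open>Entry by entry this is \<open>forest_count_rooted_balance\<close> divided by the number
  of forests.\<close>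

lemma doubly_stochastic_graph_matrix_inverse:
  fixes E :: "'n::finite set set"
  assumes "simple_graph E"
  shows "doubly_stochastic_graph_matrix E ** (mat 1 + laplacian E) = mat 1"
proof -
  have "(doubly_stochastic_graph_matrix E ** (mat 1 + laplacian E)) $ i $ j = mat 1 $ i $ j" for i j
    unfolding matrix_mult_one_plus_laplacian[OF assms]
    using forest_count_rooted_balance[OF assms, of i j] forest_count_pos[of E]
    by (simp add: doubly_stochastic_graph_matrix_def mat_def sum_divide_distrib[symmetric]
        diff_divide_distrib[symmetric])
  then show ?thesis by (simp add: vec_eq_iff)
qed

subsection \<open>The stopped Markov chain\<close>

text \<open>The transition law is given only conditionally on full histories, so both sides are
  decomposed over the histories up to time \<open>k\<close>.\<close>

lemma markov_chain_step:
  fixes X :: "nat \<Rightarrow> 'a \<Rightarrow> 'n::finite"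
  assumes "markov_chain M X P"
  shows "\<P>(\<omega> in M. X 0 \<omega> = i \<and> X (Suc k) \<omega> = y) =
    (\<Sum>x\<in>UNIV. \<P>(\<omega> in M. X 0 \<omega> = i \<and> X k \<omega> = x) * P $ x $ y)"
proof -
  interpret prob_space M using assms by (simp add: markov_chain_def)
  have meas [measurable]: "X l \<in> measurable M (count_space UNIV)" for l
    using assms by (simp add: markov_chain_def)
  \<comment> \<open>Extensional functions, so that there are finitely many histories and each
    outcome realises exactly one.\<close>
  define H where "H = (PiE {..k} (\<lambda>_. UNIV) :: (nat \<Rightarrow> 'n) set)"
  have fin: "finite H" unfolding H_def by (rule finite_PiE) auto
  let ?hist = "\<lambda>h \<omega>. \<forall>l\<le>k. X l \<omega> = h l"
  have histories: "\<exists>!h\<in>H. ?hist h \<omega>" for \<omega>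
  proof (rule ex1I[of _ "restrict (\<lambda>l. X l \<omega>) {..k}"])
    show "h = restrict (\<lambda>l. X l \<omega>) {..k}" if "h \<in> H \<and> ?hist h \<omega>" for h
      using that unfolding H_def by (intro PiE_ext[of h "{..k}" "\<lambda>_. UNIV"]) auto
  qed (auto simp: H_def)
  have split: "\<P>(\<omega> in M. Q \<omega>) = (\<Sum>h\<in>H. \<P>(\<omega> in M. Q \<omega> \<and> ?hist h \<omega>))"
    if "{\<omega> \<in> space M. Q \<omega>} \<in> events" for Q
  proof (rule prob_sum[OF fin _ that])
    show "{\<omega> \<in> space M. Q \<omega> \<and> ?hist h \<omega>} \<in> events" for h
      by (intro sets.sets_Collect_conj that) measurable
    show "AE \<omega> in M. (\<forall>h\<in>H. Q \<omega> \<and> ?hist h \<omega> \<longrightarrow> Q \<omega>) \<and> (Q \<omega> \<longrightarrow> (\<exists>!h\<in>H. Q \<omega> \<and> ?hist h \<omega>))"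
      using histories by (intro AE_I2) auto
  qed
  have step: "\<P>(\<omega> in M. X (Suc k) \<omega> = y \<and> ?hist h \<omega>) = \<P>(\<omega> in M. ?hist h \<omega>) * P $ h k $ y" for h
  proof (cases "\<P>(\<omega> in M. ?hist h \<omega>) > 0")
    case True
    then have "\<P>(\<omega> in M. X (Suc k) \<omega> = y \<bar> ?hist h \<omega>) = P $ h k $ y"
      using assms by (simp add: markov_chain_def)
    then show ?thesis
      using True by (simp add: cond_prob_def field_simps)
  next
    \<comment> \<open>On a null history no transition law is available, but both sides are
      \<open>0\<close>.\<close>
    case False
    then have "\<P>(\<omega> in M. ?hist h \<omega>) = 0"
      using measure_nonneg[of M] by (simp add: less_le)
    moreover have "\<P>(\<omega> in M. X (Suc k) \<omega> = y \<and> ?hist h \<omega>) \<le> \<P>(\<omega> in M. ?hist h \<omega>)"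
      by (rule finite_measure_mono) auto
    ultimately show ?thesis
      using measure_nonneg[of M "{\<omega> \<in> space M. X (Suc k) \<omega> = y \<and> ?hist h \<omega>}"] by simp
  qed
  have by_history: "\<P>(\<omega> in M. (X 0 \<omega> = i \<and> X (Suc k) \<omega> = y) \<and> ?hist h \<omega>) =
      (\<Sum>x\<in>UNIV. \<P>(\<omega> in M. (X 0 \<omega> = i \<and> X k \<omega> = x) \<and> ?hist h \<omega>) * P $ x $ y)" for h
  proof -
    have "\<P>(\<omega> in M. (X 0 \<omega> = i \<and> X (Suc k) \<omega> = y) \<and> ?hist h \<omega>) =
        of_bool (h 0 = i) * \<P>(\<omega> in M. X (Suc k) \<omega> = y \<and> ?hist h \<omega>)"
    proof (cases "h 0 = i")
      case True
      then show ?thesis by (auto intro!: arg_cong[of _ _ prob])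
    next
      case False
      then have "{\<omega> \<in> space M. (X 0 \<omega> = i \<and> X (Suc k) \<omega> = y) \<and> ?hist h \<omega>} = {}" by auto
      then show ?thesis using False by (simp only: measure_empty) simp
    qed
    also have "\<dots> = of_bool (h 0 = i) * \<P>(\<omega> in M. ?hist h \<omega>) * P $ h k $ y"
      using step by simp
    \<comment> \<open>The sum over \<open>x\<close> is introduced artificially: on the history
      \<open>h\<close> only the state \<open>h k\<close> occurs at time \<open>k\<close>.\<close>
    also have "\<dots> = (\<Sum>x\<in>UNIV. if x = h k then of_bool (h 0 = i) * \<P>(\<omega> in M. ?hist h \<omega>) * P $ x $ y else 0)"
      by simp
    also have "\<dots> = (\<Sum>x\<in>UNIV. \<P>(\<omega> in M. (X 0 \<omega> = i \<and> X k \<omega> = x) \<and> ?hist h \<omega>) * P $ x $ y)"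
    proof (rule sum.cong[OF refl])
      fix x
      have "\<P>(\<omega> in M. (X 0 \<omega> = i \<and> X k \<omega> = x) \<and> ?hist h \<omega>) =
          (if x = h k then of_bool (h 0 = i) * \<P>(\<omega> in M. ?hist h \<omega>) else 0)"
      proof (cases "x = h k \<and> h 0 = i")
        case True
        then show ?thesis by (auto intro!: arg_cong[of _ _ prob])
      next
        case False
        then have "{\<omega> \<in> space M. (X 0 \<omega> = i \<and> X k \<omega> = x) \<and> ?hist h \<omega>} = {}" by auto
        then show ?thesis using False by (simp only: measure_empty) simp
      qed
      then show "(if x = h k then of_bool (h 0 = i) * \<P>(\<omega> in M. ?hist h \<omega>) * P $ x $ y else 0) =
          \<P>(\<omega> in M. (X 0 \<omega> = i \<and> X k \<omega> = x) \<and> ?hist h \<omega>) * P $ x $ y"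
        by simp
    qed
    finally show ?thesis .
  qed
  have ev: "{\<omega> \<in> space M. X 0 \<omega> = i \<and> X l \<omega> = x} \<in> events" for l x
    by measurable
  have "\<P>(\<omega> in M. X 0 \<omega> = i \<and> X (Suc k) \<omega> = y) =
      (\<Sum>h\<in>H. \<Sum>x\<in>UNIV. \<P>(\<omega> in M. (X 0 \<omega> = i \<and> X k \<omega> = x) \<and> ?hist h \<omega>) * P $ x $ y)"
    unfolding split[OF ev[of "Suc k" y]] by (intro sum.cong refl by_history)
  also have "\<dots> = (\<Sum>x\<in>UNIV. \<Sum>h\<in>H. \<P>(\<omega> in M. (X 0 \<omega> = i \<and> X k \<omega> = x) \<and> ?hist h \<omega>) * P $ x $ y)"
    by (rule sum.swap)
  also have "\<dots> = (\<Sum>x\<in>UNIV. \<P>(\<omega> in M. X 0 \<omega> = i \<and> X k \<omega> = x) * P $ x $ y)"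
    unfolding split[OF ev[of k]] by (simp only: sum_distrib_right)
  finally show ?thesis .
qed

text \<open>Both events lie in the generated sigma-algebras: one is the preimage of a singleton, the
  other of a cylinder set of trajectories.\<close>

lemma independent_of_process_prob:
  fixes X :: "nat \<Rightarrow> 'a \<Rightarrow> 'n::finite"
  assumes "prob_space M" "independent_of_process M K X"
  shows "\<P>(\<omega> in M. K \<omega> = k \<and> X 0 \<omega> = i \<and> X l \<omega> = j) =
    \<P>(\<omega> in M. K \<omega> = k) * \<P>(\<omega> in M. X 0 \<omega> = i \<and> X l \<omega> = j)"
proof -
  interpret prob_space M by fact
  let ?N = "Pi\<^sub>M UNIV (\<lambda>_. count_space UNIV) :: (nat \<Rightarrow> 'n) measure"
  have A: "{\<omega> \<in> space M. K \<omega> = k} \<in> sets (vimage_algebra (space M) K (count_space UNIV))"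
  proof -
    have "K -` {k} \<inter> space M \<in> sets (vimage_algebra (space M) K (count_space UNIV))"
      by (rule in_vimage_algebra) simp
    then show ?thesis by (simp add: vimage_def Int_def conj_commute)
  qed
  have B: "{\<omega> \<in> space M. X 0 \<omega> = i \<and> X l \<omega> = j} \<in> sets (vimage_algebra (space M) (\<lambda>\<omega> k. X k \<omega>) ?N)"
  proof -
    have "{x \<in> space ?N. x 0 = i \<and> x l = j} \<in> sets ?N" by measurable
    then have "(\<lambda>\<omega> k. X k \<omega>) -` {x \<in> space ?N. x 0 = i \<and> x l = j} \<inter> space M \<in>
        sets (vimage_algebra (space M) (\<lambda>\<omega> k. X k \<omega>) ?N)"
      by (rule in_vimage_algebra)
    then show ?thesis by (simp add: vimage_def Int_def conj_commute space_PiM)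
  qed
  have "prob ({\<omega> \<in> space M. K \<omega> = k} \<inter> {\<omega> \<in> space M. X 0 \<omega> = i \<and> X l \<omega> = j}) =
      prob {\<omega> \<in> space M. K \<omega> = k} * prob {\<omega> \<in> space M. X 0 \<omega> = i \<and> X l \<omega> = j}"
    using assms(2) A B by (intro indep_setD) (auto simp: independent_of_process_def)
  moreover have "{\<omega> \<in> space M. K \<omega> = k} \<inter> {\<omega> \<in> space M. X 0 \<omega> = i \<and> X l \<omega> = j} =
      {\<omega> \<in> space M. K \<omega> = k \<and> X 0 \<omega> = i \<and> X l \<omega> = j}" by auto
  ultimately show ?thesis by simp
qed

text \<open>Memorylessness of the geometric law: the term for \<open>K = Suc k\<close> is
  \<open>1 - p\<close> times the term for \<open>K = k\<close> advanced one step by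
  \<open>P\<close>. The first summand is the case \<open>K = 0\<close>.\<close>

lemma geometrically_stopped_chain:
  fixes X :: "nat \<Rightarrow> 'a \<Rightarrow> 'n::finite" and p :: real
  assumes chain: "markov_chain M X P"
    and K [measurable]: "K \<in> measurable M (count_space UNIV)"
    and law: "\<And>k. \<P>(\<omega> in M. K \<omega> = k) = p * (1 - p) ^ k"
    and indep: "independent_of_process M K X"
  shows "\<P>(\<omega> in M. X 0 \<omega> = i \<and> X (K \<omega>) \<omega> = j) =
    p * (if i = j then \<P>(\<omega> in M. X 0 \<omega> = i) else 0) +
    (1 - p) * (\<Sum>x\<in>UNIV. \<P>(\<omega> in M. X 0 \<omega> = i \<and> X (K \<omega>) \<omega> = x) * P $ x $ j)"
proof -
  interpret prob_space M using chain by (simp add: markov_chain_def)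
  have meas [measurable]: "X l \<in> measurable M (count_space UNIV)" for l
    using chain by (simp add: markov_chain_def)
  define u where "u k x = \<P>(\<omega> in M. X 0 \<omega> = i \<and> X k \<omega> = x)" for k x
  define w where "w x = \<P>(\<omega> in M. X 0 \<omega> = i \<and> X (K \<omega>) \<omega> = x)" for x
  have w: "(\<lambda>k. p * (1 - p) ^ k * u k x) sums w x" for x
  proof -
    have "(\<lambda>k. \<P>(\<omega> in M. K \<omega> = k \<and> X 0 \<omega> = i \<and> X k \<omega> = x)) sums w x"
      unfolding w_def
    proof (rule prob_sums)
      have "{\<omega> \<in> space M. X 0 \<omega> = i \<and> X (K \<omega>) \<omega> = x} =
          {\<omega> \<in> space M. \<exists>k. K \<omega> = k \<and> X 0 \<omega> = i \<and> X k \<omega> = x}" by auto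
      also have "\<dots> \<in> events" by measurable
      finally show "{\<omega> \<in> space M. X 0 \<omega> = i \<and> X (K \<omega>) \<omega> = x} \<in> events" .
    qed auto
    then show ?thesis
      using independent_of_process_prob[OF prob_space_axioms indep] law by (simp add: u_def)
  qed
  have "(\<lambda>k. (1 - p) * (\<Sum>x\<in>UNIV. p * (1 - p) ^ k * u k x * P $ x $ j)) sums
      ((1 - p) * (\<Sum>x\<in>UNIV. w x * P $ x $ j))"
    by (intro sums_mult sums_sum sums_mult2 w)
  moreover have "(1 - p) * (\<Sum>x\<in>UNIV. p * (1 - p) ^ k * u k x * P $ x $ j) =
      p * (1 - p) ^ Suc k * u (Suc k) j" for k
    using markov_chain_step[OF chain, of i k j] by (simp add: u_def sum_distrib_left ac_simps)
  ultimately have "(\<lambda>k. p * (1 - p) ^ Suc k * u (Suc k) j) sums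
      ((1 - p) * (\<Sum>x\<in>UNIV. w x * P $ x $ j))"
    by simp
  \<comment> \<open>\<open>sums_Suc\<close> restores the term for \<open>k = 0\<close>, which yields
    a second value for the series of \<open>w j\<close>.\<close>
  then have "(\<lambda>k. p * (1 - p) ^ k * u k j) sums
      ((1 - p) * (\<Sum>x\<in>UNIV. w x * P $ x $ j) + p * (1 - p) ^ 0 * u 0 j)"
    by (rule sums_Suc)
  then have "w j = (1 - p) * (\<Sum>x\<in>UNIV. w x * P $ x $ j) + p * u 0 j"
    using sums_unique2[OF w] by fastforce
  moreover have "u 0 j = (if i = j then \<P>(\<omega> in M. X 0 \<omega> = i) else 0)"
  proof (cases "i = j")
    case False
    then have "{\<omega> \<in> space M. X 0 \<omega> = i \<and> X 0 \<omega> = j} = {}" by auto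
    then show ?thesis using False by (simp only: u_def measure_empty) simp
  qed (simp add: u_def)
  ultimately show ?thesis by (simp add: w_def)
qed

text \<open>\<open>cond_prob\<close> is a quotient, so a row of
  \<open>stopped_transition_matrix\<close> has its intended meaning only for an initial state of
  positive probability; hence the guard in the conclusion.\<close>

theorem theorem4:
  fixes E :: "'n::finite set set"
    and M :: "'a measure"
    and X :: "nat \<Rightarrow> 'a \<Rightarrow> 'n"
    and K :: "'a \<Rightarrow> nat"
  assumes "CARD('n) \<ge> 2"
    and "simple_graph E"
    and "markov_chain M X (transition_matrix E)"
    and "K \<in> measurable M (count_space UNIV)"
    and "\<And>k. \<P>(\<omega> in M. K \<omega> = k) = 1 / real CARD('n) * (1 - 1 / real CARD('n)) ^ k"
    and "independent_of_process M K X"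
  shows "\<forall>i. \<P>(\<omega> in M. X 0 \<omega> = i) > 0 \<longrightarrow>
           (\<forall>j. stopped_transition_matrix M X K $ i $ j = doubly_stochastic_graph_matrix E $ i $ j)"
proof (intro allI impI)
  fix i j
  let ?n = "real CARD('n)"
  define c where "c = \<P>(\<omega> in M. X 0 \<omega> = i)"
  define w where "w x = \<P>(\<omega> in M. X 0 \<omega> = i \<and> X (K \<omega>) \<omega> = x)" for x
  \<comment> \<open>All rows of \<open>W\<close> are the same vector \<open>w\<close>, so that an
    equation for one row can be handled by square matrix algebra.\<close>
  define W :: "real ^ 'n ^ 'n" where "W = (\<chi> a x. w x)"
  let ?L = "laplacian E"
  let ?F = "doubly_stochastic_graph_matrix E"
  assume "\<P>(\<omega> in M. X 0 \<omega> = i) > 0"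
  then have c: "c > 0" by (simp add: c_def)
  have row: "w y + (\<Sum>x\<in>UNIV. w x * ?L $ x $ y) = (if i = y then c else 0)" for y
  proof -
    define s where "s = (\<Sum>x\<in>UNIV. w x * ?L $ x $ y)"
    have "(\<Sum>x\<in>UNIV. w x * transition_matrix E $ x $ y) =
        (\<Sum>x\<in>UNIV. (if x = y then w x else 0) - inverse (?n - 1) * (w x * ?L $ x $ y))"
      by (intro sum.cong) (auto simp: transition_matrix_def mat_def algebra_simps)
    also have "\<dots> = w y - inverse (?n - 1) * s"
      by (simp add: sum_subtractf sum_distrib_left s_def)
    finally have "w y = 1 / ?n * (if i = y then c else 0) + (1 - 1 / ?n) * (w y - inverse (?n - 1) * s)"
      using geometrically_stopped_chain[OF assms(3-6), of i y] by (simp add: w_def c_def)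
    \<comment> \<open>Hence \<open>(1 - 1 / ?n) * inverse (?n - 1) = 1 / ?n\<close>, and multiplying
      the equation by \<open>?n\<close> leaves \<open>w y + s\<close> on one side.\<close>
    moreover have "?n > 1" using assms(1) by simp
    ultimately have "w y + s = (if i = y then c else 0)"
      by (simp add: divide_simps split: if_splits) (auto simp: algebra_simps)
    then show ?thesis by (simp add: s_def)
  qed
  have WL: "W ** (mat 1 + ?L) = (\<chi> a y. if i = y then c else 0)"
    using row by (simp add: W_def matrix_add_ldistrib vec_eq_iff) (simp add: matrix_matrix_mult_def)
  \<comment> \<open>The forest identity gives \<open>?F\<close> as a left inverse, but
    \<open>W\<close> has \<open>mat 1 + ?L\<close> on its right; for square matrices the two sides
    agree.\<close>
  have "(mat 1 + ?L) ** ?F = mat 1"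
    using doubly_stochastic_graph_matrix_inverse[OF assms(2)] matrix_left_right_inverse by blast
  then have "W = (W ** (mat 1 + ?L)) ** ?F"
    by (simp add: matrix_mul_assoc[symmetric])
  then have "W $ i $ j = ((\<chi> a y. if i = y then c else 0) ** ?F) $ i $ j"
    unfolding WL by (rule arg_cong)
  then have "w j = c * ?F $ i $ j"
    by (simp add: W_def matrix_matrix_mult_def mult_delta_left)
  then show "stopped_transition_matrix M X K $ i $ j = ?F $ i $ j"
    using c by (simp add: stopped_transition_matrix_def cond_prob_def w_def c_def conj_commute)
qed

end
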